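(* Let $p>3$ be a prime, let $q$ be a power of $p$, and let $a\in\mathbb{F}_q$ with $a\neq 0,\ 1/9,\ 4/27$. Then the equality $$\sum_{0<k<q/3}\binom{3k}{k}a^k=0$$ holds in $\mathbb{F}_q$ if, and only if, the polynomial $a(1-z)^3-z^2\in\mathbb{F}_q[z]$ has three roots in $\mathbb{F}_q$.
   Context: $\mathbb{F}_q$ denotes the field with $q$ elements, $q=p^f$ with $f\ge1$; the integers $\binom{3k}{k}$ and the fractions $1/9$, $4/27$ are interpreted in $\mathbb{F}_q$ via reduction modulo $p$. The sum is over integers $k$ in the indicated range. *)

theory Defs
  imports Complex_Main "HOL-Library.Cardinality" "HOL-Computational_Algebra.Computational_Algebra"
begin

end

theory Submission
  imports Defs
begin

text \<open>
  The substitution \<open>t = z / (z - 1)\<close> turns the cubic of the theorem into \<open>t^3 - t^2 + a\<close>. Modulo this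
  cubic, \<open>X^n\<close> is expressed by the recurrence \<open>u (n + 3) = u (n + 2) - a * u n\<close>, whose solution is
  \<open>\<Sum>k. (n - 2 k choose k) * (-a)^k\<close>. Since \<open>q - m choose k = (-1)^k * (m + k - 1 choose k)\<close> modulo \<open>p\<close>,
  the values at \<open>q - 1\<close> and \<open>q\<close> are determined by the sum \<open>S\<close> of the theorem, and \<open>S = 0\<close> means that
  \<open>X^q = X + c * (X^2 - X)\<close> modulo the cubic for some constant \<open>c\<close>. As \<open>X^q\<close> is again a root of the
  cubic, this forces \<open>c = 0\<close> unless \<open>a = 1/9\<close>; and \<open>c = 0\<close> says that the cubic divides \<open>X^q - X\<close>.
\<close>

section \<open>Finite fields\<close>

text \<open>Multiplication by a nonzero \<open>x\<close> permutes the nonzero elements, so their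
  product, which is nonzero, can be cancelled.\<close>

lemma finite_field_power_CARD:
  fixes x :: "'a :: {field, finite}"
  shows "x ^ CARD('a) = x"
proof (cases "x = 0")
  case False
  have card: "CARD('a) = Suc (card (UNIV - {0 :: 'a}))"
    by (rule card.remove) simp_all
  have "(\<Prod>y\<in>UNIV - {0}. y) = (\<Prod>y\<in>UNIV - {0}. x * y)"
    by (rule prod.reindex_bij_witness[of _ "\<lambda>y. x * y" "\<lambda>y. y / x"]) (use False in auto)
  also have "\<dots> = x ^ card (UNIV - {0 :: 'a}) * (\<Prod>y\<in>UNIV - {0}. y)"
    by (simp add: prod.distrib)
  finally have "x ^ card (UNIV - {0 :: 'a}) = 1"
    by simp
  thus ?thesis
    by (simp only: card power_Suc) simp
qed simp

text \<open>Translation by 1 permutes the field; comparing sums gives \<open>CARD('a) = 0\<close> in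
  it, so the prime \<open>CHAR('a)\<close> divides \<open>p ^ f\<close>.\<close>

lemma CHAR_eq_of_CARD_eq_prime_power:
  assumes "prime p" and "CARD('a :: {field, finite}) = p ^ f"
  shows "CHAR('a) = p"
proof -
  have "prime CHAR('a)"
    by (simp add: finite_imp_CHAR_pos prime_CHAR_semidom)
  moreover have "CHAR('a) dvd p ^ f"
  proof -
    have "(\<Sum>x\<in>UNIV. x + 1) = (\<Sum>x\<in>UNIV. x :: 'a)"
      by (rule sum.reindex_bij_witness[of _ "\<lambda>x. x - 1" "\<lambda>x. x + 1"]) auto
    hence "of_nat CARD('a) = (0 :: 'a)"
      by (simp add: sum.distrib)
    thus ?thesis
      using assms(2) of_nat_eq_0_iff_char_dvd by metis
  qed
  ultimately show ?thesis
    using assms(1) prime_dvd_power primes_dvd_imp_eq by blast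
qed

text \<open>Every field element is a root of \<open>X^q - X\<close>. If this is
  \<open>g * h\<close>, the roots of \<open>g\<close> and \<open>h\<close> cover all
  \<open>q\<close> elements, so both degree bounds are attained. Conversely, the remainder modulo
  \<open>g\<close> vanishes at all \<open>degree g\<close> roots although its degree is
  smaller.\<close>

lemma dvd_Frobenius_iff_card_roots:
  fixes g :: "'a :: {field, finite} poly"
  assumes nz: "g \<noteq> 0"
  shows "g dvd monom 1 CARD('a) - monom 1 1 \<longleftrightarrow> card {x. poly g x = 0} = degree g"
proof -
  let ?q = "CARD('a)"
  let ?P = "monom 1 ?q - monom 1 1 :: 'a poly"
  have q: "?q > 1"
    using card_mono[of UNIV "{0 :: 'a, 1}"] by simp
  hence "degree (- monom 1 1 :: 'a poly) < degree (monom 1 ?q :: 'a poly)"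
    by (simp add: degree_monom_eq)
  from degree_add_eq_left[OF this] have deg: "degree ?P = ?q"
    by (simp add: degree_monom_eq)
  have root: "poly ?P x = 0" for x
    by (simp add: poly_monom finite_field_power_CARD)
  show ?thesis
  proof
    assume "g dvd ?P"
    then obtain h where h: "?P = g * h"
      by blast
    have "h \<noteq> 0"
      using h deg q by auto
    have "{x. poly g x = 0} \<union> {x. poly h x = 0} = UNIV"
      using root unfolding h by auto
    hence "?q \<le> card {x. poly g x = 0} + card {x. poly h x = 0}"
      by (metis card_Un_le)
    moreover have "?q = degree g + degree h"
      using h deg nz \<open>h \<noteq> 0\<close> by (simp add: degree_mult_eq)
    ultimately show "card {x. poly g x = 0} = degree g"
      using card_poly_roots_bound[OF nz] card_poly_roots_bound[OF \<open>h \<noteq> 0\<close>] by linarith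
  next
    assume card: "card {x. poly g x = 0} = degree g"
    have "?P mod g = 0"
    proof (rule ccontr)
      assume mod: "?P mod g \<noteq> 0"
      have "poly (?P mod g) x = 0" if "poly g x = 0" for x
        using root[of x] that poly_mod[of g x ?P] by simp
      hence "card {x. poly g x = 0} \<le> card {x. poly (?P mod g) x = 0}"
        by (intro card_mono) auto
      also have "\<dots> \<le> degree (?P mod g)"
        by (rule card_poly_roots_bound[OF mod])
      also have "\<dots> < degree g"
        using degree_mod_less[OF nz] mod by blast
      finally show False
        using card by simp
    qed
    thus "g dvd ?P"
      by blast
  qed
qed

section \<open>Binomial coefficients modulo a prime\<close>

text \<open>By absorption \<open>p ^ f\<close> divides \<open>k * (p ^ f choose k)\<close>; were the
  binomial prime to \<open>p\<close>, then \<open>p ^ f\<close> would divide the smaller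
  \<open>k\<close>.\<close>

lemma prime_power_choose_eq_0:
  assumes "prime p" "CHAR('a :: comm_ring_1) = p" "0 < k" "k < p ^ f"
  shows "of_nat (p ^ f choose k) = (0 :: 'a)"
proof -
  have "p dvd (p ^ f choose k)"
  proof (rule ccontr)
    assume "\<not> p dvd (p ^ f choose k)"
    hence "coprime (p ^ f) (p ^ f choose k)"
      using assms(1) by (simp add: prime_imp_coprime)
    moreover have "p ^ f dvd k * (p ^ f choose k)"
      by (simp add: times_binomial_minus1_eq assms(3))
    ultimately have "p ^ f dvd k"
      by (simp add: coprime_dvd_mult_left_iff)
    thus False
      using assms(3,4) by (simp add: nat_dvd_not_less)
  qed
  thus ?thesis
    using assms(2) by (simp add: of_nat_eq_0_iff_char_dvd)
qed

text \<open>This is upper negation, as \<open>q - m\<close> is \<open>-m\<close> modulo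
  \<open>p\<close>. Since \<open>k!\<close> may vanish modulo \<open>p\<close>, the proof is by
  Pascal's rule, with an induction on \<open>k\<close> inside one on \<open>m\<close>.\<close>

lemma prime_power_diff_choose:
  assumes "prime p" "CHAR('a :: comm_ring_1) = p" "q = p ^ f" "m + k \<le> q" "k < q"
  shows "of_nat ((q - m) choose k) = ((-1) ^ k * of_nat ((m + k - 1) choose k) :: 'a)"
  using assms(4,5)
proof (induction m arbitrary: k)
  \<comment> \<open>For \<open>k > 0\<close> the right side contains \<open>k - 1 choose k\<close>,
    which is 0; for \<open>k = 0\<close> the truncated \<open>0 - 1\<close> still gives 1.\<close>
  case 0
  show ?case
    using 0 prime_power_choose_eq_0[OF assms(1,2), of k f]
    by (cases k) (simp_all add: assms(3) binomial_eq_0)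
next
  case (Suc m)
  note IH = Suc.IH
  from Suc.prems show ?case
  proof (induction k)
    case (Suc k)
    have IHm: "of_nat ((q - m) choose Suc k) = ((-1) ^ Suc k * of_nat ((m + k) choose Suc k) :: 'a)"
      using IH[of "Suc k"] Suc.prems by simp
    have IHk: "of_nat ((q - Suc m) choose k) = ((-1) ^ k * of_nat ((m + k) choose k) :: 'a)"
      using Suc by simp
    have "q - m = Suc (q - Suc m)"
      using Suc.prems by simp
    hence "of_nat ((q - Suc m) choose Suc k)
        = (of_nat ((q - m) choose Suc k) - of_nat ((q - Suc m) choose k) :: 'a)"
      by simp
    also have "\<dots> = (-1) ^ Suc k * of_nat ((Suc m + Suc k - 1) choose Suc k)"
      by (simp add: IHm IHk algebra_simps)
    finally show ?case .
  qed simp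
qed

lemma three_times_choose_pred:
  assumes "k > 0"
  shows "3 * ((3 * k - 1) choose k) = 2 * ((3 * k) choose k)"
proof -
  have "(3 * k - k) * ((3 * k) choose k) = 3 * k * ((3 * k - 1) choose k)"
    by (rule binomial_absorb_comp)
  thus ?thesis
    using assms by simp
qed

section \<open>Powers modulo the cubic\<close>

definition cubic :: "'a :: comm_ring_1 \<Rightarrow> 'a poly" where
  "cubic a = [:a, 0, -1, 1:]"

text \<open>These are the coefficients of the power series \<open>1 / (1 - X - b * X^3)\<close>.
  Where \<open>n - 2 * k\<close> is truncated, it is 0 with \<open>k > 0\<close>, so the term
  vanishes.\<close>

definition binom_seq :: "'a :: comm_ring_1 \<Rightarrow> nat \<Rightarrow> 'a" where
  "binom_seq b n = (\<Sum>k\<le>n. of_nat ((n - 2 * k) choose k) * b ^ k)"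

lemma binom_seq_extend:
  assumes "n \<le> N"
  shows "binom_seq b n = (\<Sum>k\<le>N. of_nat ((n - 2 * k) choose k) * b ^ k)"
  unfolding binom_seq_def
  by (rule sum.mono_neutral_left) (use assms in \<open>auto simp: binomial_eq_0\<close>)

text \<open>Pascal's rule applies term by term once the three sums are extended to compatible
  ranges; the shift of \<open>k\<close> by one produces the factor \<open>b\<close>.\<close>

lemma binom_seq_rec: "binom_seq b (n + 3) = binom_seq b (n + 2) + b * binom_seq b n"
proof -
  have pascal: "(n + 3 - 2 * Suc k) choose Suc k
      = ((n + 2 - 2 * Suc k) choose Suc k) + ((n - 2 * k) choose k)" for k
  proof (cases "2 * k \<le> n")
    case True
    hence "n + 3 - 2 * Suc k = Suc (n - 2 * k)"
      by simp
    moreover have "n + 2 - 2 * Suc k = n - 2 * k"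
      by simp
    ultimately show ?thesis
      by (simp only: binomial_Suc_Suc)
  qed auto
  have "binom_seq b (n + 3) = (\<Sum>k\<le>Suc (n + 2). of_nat ((n + 3 - 2 * k) choose k) * b ^ k)"
    by (rule binom_seq_extend) simp
  also have "\<dots> = (\<Sum>k\<le>Suc (n + 2). of_nat ((n + 2 - 2 * k) choose k) * b ^ k)
      + b * (\<Sum>k\<le>n + 2. of_nat ((n - 2 * k) choose k) * b ^ k)"
    by (simp only: sum.atMost_Suc_shift pascal)
      (simp add: sum.distrib sum_distrib_left algebra_simps)
  also have "\<dots> = binom_seq b (n + 2) + b * binom_seq b n"
    by (simp only: binom_seq_extend[symmetric] le_add1 le_SucI order_refl)
  finally show ?thesis .
qed

text \<open>In the induction step the remainder is multiplied by \<open>X\<close>, and its leading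
  term is reduced by \<open>X^3 = X^2 - a\<close>.\<close>

lemma cubic_dvd_power_minus:
  fixes a :: "'a :: comm_ring_1"
  defines "v \<equiv> binom_seq (-a)"
  shows "cubic a dvd monom 1 (n + 2) - [:v (n + 2) - v (n + 1), v (n + 1) - v n, v n:]"
proof (induction n)
  case 0
  have "v 0 = 1" "v 1 = 1" "v 2 = 1"
    by (simp_all add: v_def binom_seq_def numeral_2_eq_2)
  thus ?case
    by (simp add: monom_altdef numeral_2_eq_2)
next
  case (Suc n)
  have rec: "v (n + 3) = v (n + 2) - a * v n"
    by (simp add: v_def binom_seq_rec)
  have eq: "monom 1 (Suc n + 2) - [:v (n + 3) - v (n + 2), v (n + 2) - v (n + 1), v (n + 1):]
      = [:0, 1:] * (monom 1 (n + 2) - [:v (n + 2) - v (n + 1), v (n + 1) - v n, v n:])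
        + [:v n:] * cubic a"
    by (simp add: cubic_def monom_Suc rec algebra_simps)
  have "cubic a dvd monom 1 (Suc n + 2) - [:v (n + 3) - v (n + 2), v (n + 2) - v (n + 1), v (n + 1):]"
    unfolding eq by (intro dvd_add dvd_mult Suc.IH dvd_refl)
  thus ?case
    by (simp add: eval_nat_numeral)
qed

lemma eq_0_if_cubic_dvd:
  fixes a :: "'a :: field"
  assumes "cubic a dvd [:x, y, z:]"
  shows "x = 0 \<and> y = 0 \<and> z = 0"
proof -
  have "degree [:x, y, z:] < degree (cubic a)"
    by (simp add: cubic_def)
  thus ?thesis
    using dvd_imp_degree_le[OF assms] by (metis not_le pCons_eq_0_iff)
qed

text \<open>
  Dividing the hypothesis by \<open>c * (x^2 - x)\<close> is possible because \<open>A = - x * (x^2 - x)\<close> modulo the cubic.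
\<close>
lemma cubic_at_shifted_root:
  fixes x c A :: "'a :: comm_ring_1"
  defines "F \<equiv> x ^ 3 - x ^ 2 + A" and "T \<equiv> x + c * (x ^ 2 - x)"
  assumes "F dvd T ^ 3 - T ^ 2 + A"
  shows "F dvd A * c * ((3 - c) * x ^ 2 + (c - 2 - A * c ^ 2) * x + (A * c ^ 2 - 3 * A * c))"
proof -
  \<comment> \<open>With \<open>F\<close> read as a monic cubic in \<open>x\<close>,
    \<open>g\<close> and \<open>h\<close> are the remainder and quotient of the cofactor of
    \<open>c * d\<close> in \<open>T ^ 3 - T ^ 2 + A - F\<close>.\<close>
  define g where "g = (3 - c) * x ^ 2 + (c - 2 - A * c ^ 2) * x + (A * c ^ 2 - 3 * A * c)"
  define h where "h = 3 * c + c ^ 2 * (x - 1)"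
  define d where "d = x ^ 2 - x"
  have "3 * x ^ 2 - 2 * x + (3 * x - 1) * (c * d) + (c * d) ^ 2 = g + F * h"
    unfolding g_def h_def F_def d_def
    by (simp add: algebra_simps power2_eq_square power3_eq_cube)
  moreover have "(x + y) ^ 3 - (x + y) ^ 2 + A
      = F + y * (3 * x ^ 2 - 2 * x + (3 * x - 1) * y + y ^ 2)" for y
    unfolding F_def by (simp add: algebra_simps power2_eq_square power3_eq_cube)
  ultimately have T: "T ^ 3 - T ^ 2 + A = F + c * d * (g + F * h)"
    by (simp add: T_def flip: d_def)
  have A: "A = F - x * d"
    by (simp add: F_def d_def algebra_simps power2_eq_square power3_eq_cube)
  have "A * c * g = F * (c * g + x + x * c * d * h) - x * (T ^ 3 - T ^ 2 + A)"
    unfolding T by (subst A) (simp add: algebra_simps)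
  thus ?thesis
    using assms(3) unfolding g_def by (metis dvd_diff dvd_mult dvd_triv_left)
qed

text \<open>The last hypothesis, with 3 invertible, makes \<open>v q\<close> equal 1 as soon as
  \<open>v (q - 1)\<close> does. Then only \<open>c = v (q - 2)\<close> remains unknown in the
  remainder \<open>R\<close> of \<open>X ^ q\<close>.\<close>

lemma cubic_dvd_Frobenius_iff:
  fixes a :: "'a :: {field, finite}"
  assumes "CHAR('a) = p" "prime p" "p > 3" "CARD('a) = p ^ f" "a \<noteq> 0" "9 * a \<noteq> 1"
    and "3 * binom_seq (-a) CARD('a) - 1 = 2 * binom_seq (-a) (CARD('a) - 1)"
  shows "cubic a dvd monom 1 CARD('a) - monom 1 1 \<longleftrightarrow> binom_seq (-a) (CARD('a) - 1) = 1"
proof -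
  define q where "q = CARD('a)"
  define v where "v = binom_seq (-a)"
  define c where "c = v (q - 2)"
  define X where "X = (monom 1 1 :: 'a poly)"
  define R where "R = [:v q - v (q - 1), v (q - 1) - c, c:]"
  have q: "q \<ge> 2"
    unfolding q_def using card_mono[of UNIV "{0 :: 'a, 1}"] by simp
  have "q - 2 + 2 = q" "q - 2 + 1 = q - 1"
    using q by simp_all
  hence dvd: "cubic a dvd X ^ q - R"
    using cubic_dvd_power_minus[of a "q - 2"] by (simp add: v_def c_def R_def X_def monom_power)
  have three: "(3 :: 'a) \<noteq> 0"
  proof
    assume "(3 :: 'a) = 0"
    hence "of_nat 3 = (0 :: 'a)"
      by simp
    hence "p dvd 3"
      using assms(1) of_nat_eq_0_iff_char_dvd by blast
    thus False
      using assms(3) by (simp add: nat_dvd_not_less)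
  qed
  have Fr: "monom 1 CARD('a) - monom 1 1 = X ^ q - X"
    by (simp add: X_def q_def monom_power)
  show ?thesis
  proof
    assume "cubic a dvd monom 1 CARD('a) - monom 1 1"
    hence "cubic a dvd (X ^ q - X) - (X ^ q - R)"
      using dvd Fr by (metis dvd_diff)
    hence "cubic a dvd R - X"
      by simp
    also have "R - X = [:v q - v (q - 1), v (q - 1) - c - 1, c:]"
      by (simp add: R_def X_def monom_altdef)
    finally have "c = 0 \<and> v (q - 1) - c - 1 = 0"
      using eq_0_if_cubic_dvd by blast
    hence "v (q - 1) = 1"
      by (metis diff_zero eq_iff_diff_eq_0)
    thus "binom_seq (-a) (CARD('a) - 1) = 1"
      unfolding v_def q_def .
  next
    assume v1: "binom_seq (-a) (CARD('a) - 1) = 1"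
    hence "3 * v q = 3 * 1"
      using assms(7) by (simp add: v_def q_def algebra_simps)
    hence vq: "v q = 1"
      using three by (metis mult_cancel_left)
    have R: "R = X + [:c:] * (X ^ 2 - X)"
      using v1 vq
      by (simp add: R_def X_def monom_altdef v_def q_def power2_eq_square)
    have cubic: "cubic a = X ^ 3 - X ^ 2 + [:a:]"
      by (simp add: cubic_def X_def monom_altdef power3_eq_cube power2_eq_square)
    have dream: "(r + s) ^ q = r ^ q + s ^ q" for r s :: "'a poly"
      by (rule freshmans_dream'[where n = f]) (use assms in \<open>simp_all add: q_def\<close>)
    \<comment> \<open>With \<open>X ^ 2\<close> moved to the left, only additivity of the Frobenius
      map is required, not its effect on signs.\<close>
    have "cubic a ^ q + (X ^ 2) ^ q = (X ^ 3) ^ q + [:a:] ^ q"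
      by (simp add: cubic flip: dream)
    moreover have "[:a:] ^ q = [:a:]"
      using finite_field_power_CARD[of a] by (simp add: q_def poly_const_pow)
    ultimately have "cubic a ^ q = (X ^ q) ^ 3 - (X ^ q) ^ 2 + [:a:]"
      by (simp add: algebra_simps flip: power_mult)
    moreover have "cubic a dvd cubic a ^ q"
      using q by (simp add: dvd_power)
    moreover have "R ^ 3 - R ^ 2 + [:a:] = ((X ^ q) ^ 3 - (X ^ q) ^ 2 + [:a:])
        - (X ^ q - R) * ((X ^ q) ^ 2 + X ^ q * R + R ^ 2 - X ^ q - R)"
      by (simp add: algebra_simps power2_eq_square power3_eq_cube)
    ultimately have "cubic a dvd R ^ 3 - R ^ 2 + [:a:]"
      using dvd by (metis dvd_diff dvd_mult2)
    hence "cubic a dvd [:a:] * [:c:] * ((3 - [:c:]) * X ^ 2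
        + ([:c:] - 2 - [:a:] * [:c:] ^ 2) * X + ([:a:] * [:c:] ^ 2 - 3 * [:a:] * [:c:]))"
      unfolding R cubic by (rule cubic_at_shifted_root)
    also have "\<dots> = smult (a * c) [:a * c ^ 2 - 3 * a * c, c - 2 - a * c ^ 2, 3 - c:]"
      by (simp add: X_def monom_altdef power2_eq_square numeral_poly algebra_simps)
    finally have coeffs: "a * c * (c - 2 - a * c ^ 2) = 0" "a * c * (3 - c) = 0"
      using eq_0_if_cubic_dvd[of a] by fastforce+
    \<comment> \<open>Otherwise the quadratic coefficient forces \<open>c = 3\<close>, and the
      linear one then reads \<open>1 - 9 * a = 0\<close>.\<close>
    have "c = 0"
    proof (rule ccontr)
      assume "c \<noteq> 0"
      hence "c = 3" "c - 2 - a * c ^ 2 = 0"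
        using coeffs assms(5) by auto
      thus False
        using assms(6) by (simp add: mult.commute)
    qed
    thus "cubic a dvd monom 1 CARD('a) - monom 1 1"
      using dvd Fr R by simp
  qed
qed

section \<open>The main theorem\<close>

text \<open>Upper negation is applied with \<open>m + 2 * k\<close> for \<open>m\<close>, and its
  sign cancels that of \<open>(-a) ^ k\<close>. The case \<open>m = 1\<close> yields the binomials
  \<open>3 * k choose k\<close> of the theorem, \<open>m = 0\<close> yields
  \<open>3 * k - 1 choose k\<close>.\<close>

lemma binom_seq_prime_power:
  fixes a :: "'a :: comm_ring_1"
  assumes "prime p" "CHAR('a) = p" "q = p ^ f" "m \<le> 1" "\<not> 3 dvd q"
  shows "binom_seq (-a) (q - m) = (\<Sum>k | 3 * k < q. of_nat ((m + 3 * k - 1) choose k) * a ^ k)"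
proof -
  have "binom_seq (-a) (q - m) = (\<Sum>k | 3 * k < q. of_nat ((q - m - 2 * k) choose k) * (-a) ^ k)"
    unfolding binom_seq_def
  proof (rule sum.mono_neutral_right)
    show "\<forall>k\<in>{..q - m} - {k. 3 * k < q}. of_nat ((q - m - 2 * k) choose k) * (-a) ^ k = 0"
    proof
      fix k assume "k \<in> {..q - m} - {k. 3 * k < q}"
      \<comment> \<open>At \<open>3 * k = q\<close> and \<open>m = 0\<close> the binomial would be
        \<open>k choose k = 1\<close>.\<close>
      moreover have "3 * k \<noteq> q"
        using assms(5) by auto
      ultimately have "q - m - 2 * k < k"
        by auto
      thus "of_nat ((q - m - 2 * k) choose k) * (-a) ^ k = 0"
        by (simp add: binomial_eq_0)
    qed
  qed (use assms(4) in auto)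
  also have "\<dots> = (\<Sum>k | 3 * k < q. of_nat ((m + 3 * k - 1) choose k) * a ^ k)"
  proof (rule sum.cong)
    fix k assume "k \<in> {k. 3 * k < q}"
    hence "of_nat ((q - (m + 2 * k)) choose k)
        = ((-1) ^ k * of_nat ((m + 2 * k + k - 1) choose k) :: 'a)"
      using assms(4) by (intro prime_power_diff_choose[OF assms(1-3)]) auto
    moreover have "m + 2 * k + k - 1 = m + 3 * k - 1" "q - (m + 2 * k) = q - m - 2 * k"
      by simp_all
    ultimately have "of_nat ((q - m - 2 * k) choose k)
        = ((-1) ^ k * of_nat ((m + 3 * k - 1) choose k) :: 'a)"
      by metis
    moreover have "(-1) ^ k * (-a) ^ k = a ^ k"
      by (simp flip: power_mult_distrib)
    ultimately show "of_nat ((q - m - 2 * k) choose k) * (-a) ^ k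
        = of_nat ((m + 3 * k - 1) choose k) * a ^ k"
      by (metis mult.assoc mult.commute)
  qed simp
  finally show ?thesis .
qed

text \<open>The map \<open>z / (z - 1)\<close> is an involution away from 1, and 1 is a root of
  neither polynomial: the values there are \<open>-1\<close> and \<open>a\<close>.\<close>

lemma card_roots_cubic_substitution:
  fixes a :: "'a :: field"
  assumes "a \<noteq> 0"
  shows "card {z. a * (1 - z) ^ 3 - z ^ 2 = 0} = card {t. poly (cubic a) t = 0}"
proof -
  have poly: "poly (cubic a) t = t ^ 3 - t ^ 2 + a" for t
    by (simp add: cubic_def algebra_simps power2_eq_square power3_eq_cube)
  have ne: "z \<noteq> 1" if "a * (1 - z) ^ 3 - z ^ 2 = 0 \<or> z ^ 3 - z ^ 2 + a = 0" for z
    using that assms by auto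
  have inv: "z / (z - 1) / (z / (z - 1) - 1) = z" if "z \<noteq> 1" for z :: 'a
    using that by (simp add: field_simps)
  have key: "(z / (z - 1)) ^ 3 - (z / (z - 1)) ^ 2 + a = - (a * (1 - z) ^ 3 - z ^ 2) / (z - 1) ^ 3"
    and key': "a * (1 - z / (z - 1)) ^ 3 - (z / (z - 1)) ^ 2 = - (z ^ 3 - z ^ 2 + a) / (z - 1) ^ 3"
    if "z \<noteq> 1" for z
  proof -
    define w where "w = z - 1"
    have w: "w \<noteq> 0" "z = w + 1"
      using that by (simp_all add: w_def)
    show "(z / (z - 1)) ^ 3 - (z / (z - 1)) ^ 2 + a = - (a * (1 - z) ^ 3 - z ^ 2) / (z - 1) ^ 3"
      using w(1) unfolding w(2) by (simp add: field_simps power2_eq_square power3_eq_cube)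
    show "a * (1 - z / (z - 1)) ^ 3 - (z / (z - 1)) ^ 2 = - (z ^ 3 - z ^ 2 + a) / (z - 1) ^ 3"
      using w(1) unfolding w(2) by (simp add: field_simps power2_eq_square power3_eq_cube)
  qed
  have "bij_betw (\<lambda>z. z / (z - 1)) {z. a * (1 - z) ^ 3 - z ^ 2 = 0} {t. t ^ 3 - t ^ 2 + a = 0}"
  proof (rule bij_betw_byWitness[where f' = "\<lambda>z. z / (z - 1)"])
    show "(\<lambda>z. z / (z - 1)) ` {z. a * (1 - z) ^ 3 - z ^ 2 = 0} \<subseteq> {t. t ^ 3 - t ^ 2 + a = 0}"
      using key ne by fastforce
    show "(\<lambda>z. z / (z - 1)) ` {t. t ^ 3 - t ^ 2 + a = 0} \<subseteq> {z. a * (1 - z) ^ 3 - z ^ 2 = 0}"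
      using key' ne by fastforce
  qed (use inv ne in blast)+
  thus ?thesis
    using bij_betw_same_card by (simp only: poly) blast
qed

theorem theorem5:
  fixes p f q :: nat and a :: "'a :: {field, finite}"
  assumes "prime p" and "p > 3"
    and "f \<ge> 1" and "q = p ^ f" and "CARD('a) = q"
    and "a \<noteq> 0" and "a \<noteq> 1 / 9" and "a \<noteq> 4 / 27"
  shows "(\<Sum>k\<in>{k::nat. 0 < k \<and> real k < real q / 3}. of_nat ((3 * k) choose k) * a ^ k) = 0
    \<longleftrightarrow> card {z. poly (smult a (([:1:] - [:0, 1:]) ^ 3) - [:0, 1:] ^ 2) z = 0} = 3"
proof -
  let ?K = "{k::nat. 0 < k \<and> 3 * k < q}"
  define S where "S = (\<Sum>k\<in>?K. of_nat ((3 * k) choose k) * a ^ k)"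
  have char: "CHAR('a) = p"
    using CHAR_eq_of_CARD_eq_prime_power assms(1,4,5) by blast
  have three_dvd: "\<not> 3 dvd q"
    using assms(1,2,4) prime_dvd_power[of 3 p f] primes_dvd_imp_eq[of 3 p] by auto
  have q: "q > 0"
    using assms(1,4) by (simp add: prime_gt_0_nat)
  have split: "{k. 3 * k < q} = insert 0 ?K" "finite ?K"
    using q by (auto intro: finite_subset[of _ "{..q}"])
  have v1: "binom_seq (-a) (q - 1) = 1 + S"
    using binom_seq_prime_power[OF assms(1) char assms(4) _ three_dvd, of 1 a] split
    by (simp add: S_def)
  \<comment> \<open>The factor 3 permits \<open>three_times_choose_pred\<close>, which turns the sum
    into \<open>2 * S\<close>; the leading 3 is the term \<open>k = 0\<close>.\<close>
  have "3 * binom_seq (-a) q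
      = 3 + (\<Sum>k\<in>?K. 3 * of_nat ((3 * k - 1) choose k) * a ^ k)"
    using binom_seq_prime_power[OF assms(1) char assms(4) _ three_dvd, of 0 a] split
    by (simp add: sum_distrib_left distrib_left mult.assoc)
  also have "(\<Sum>k\<in>?K. 3 * of_nat ((3 * k - 1) choose k) * a ^ k) = 2 * S"
    unfolding S_def sum_distrib_left
  proof (rule sum.cong)
    fix k assume "k \<in> ?K"
    hence "of_nat (3 * ((3 * k - 1) choose k)) = (of_nat (2 * ((3 * k) choose k)) :: 'a)"
      by (simp only: three_times_choose_pred mem_Collect_eq)
    thus "3 * of_nat ((3 * k - 1) choose k) * a ^ k = 2 * (of_nat ((3 * k) choose k) * a ^ k)"
      by (simp add: mult.assoc)
  qed simp
  finally have v0: "3 * binom_seq (-a) q - 1 = 2 * binom_seq (-a) (q - 1)"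
    by (simp only: v1) (simp add: distrib_left)
  have nine: "9 * a \<noteq> 1"
  proof
    assume "9 * a = 1"
    \<comment> \<open>Division by 9 is justified by the equation \<open>9 * a = 1\<close>
      itself.\<close>
    moreover from this have "(9 :: 'a) \<noteq> 0"
      by auto
    ultimately show False
      using assms(7) by (simp add: field_simps)
  qed
  have deg: "cubic a \<noteq> 0" "degree (cubic a) = 3"
    by (simp_all add: cubic_def)
  have "{k::nat. 0 < k \<and> real k < real q / 3} = ?K"
    by auto
  hence "(\<Sum>k\<in>{k::nat. 0 < k \<and> real k < real q / 3}. of_nat ((3 * k) choose k) * a ^ k) = S"
    by (simp only: S_def)
  moreover have "S = 0 \<longleftrightarrow> binom_seq (-a) (q - 1) = 1"
    by (simp only: v1) simp
  moreover have "\<dots> \<longleftrightarrow> cubic a dvd monom 1 CARD('a) - monom 1 1"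
    using cubic_dvd_Frobenius_iff[OF char assms(1,2) _ assms(6) nine] v0 assms(4,5) by simp
  moreover have "\<dots> \<longleftrightarrow> card {t. poly (cubic a) t = 0} = 3"
    using dvd_Frobenius_iff_card_roots[of "cubic a"] deg by fastforce
  moreover have "card {z. poly (smult a (([:1:] - [:0, 1:]) ^ 3) - [:0, 1:] ^ 2) z = 0}
      = card {t. poly (cubic a) t = 0}"
    using card_roots_cubic_substitution[OF assms(6)] by (simp add: poly_power)
  ultimately show ?thesis
    by simp
qed

end
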